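(* Let $C$ be a set of colours with $\#C\ge 3$, let $W_B$ be the set of brick Wang prototiles, and let $G$ be a square grid board. Then the tiling problem $(G,C,W_B)$ is always solvable if and only if the full subgraph of $G$ on its set of cells contains a cycle.
   Context: A board is a finite undirected (multi)graph $G=(V\cup\{v_0\},E)$ with a distinguished vertex $v_0$ such that for each cell $v\in V$ the set $N(v)$ of adjacent edges carries a total order $e_1(v),\dots,e_{\deg(v)}(v)$, and the full subgraph on $V$ is nonempty and connected. For the tiling problem $(G,C,W)$ with $W=\bigcup_k W_k$, $W_k\subset C^k$: a full extension of $\beta:N(v_0)\to C$ is a map $\tau:E\to C$ with $\tau|_{N(v_0)}=\beta$ and $(\tau(e_1(v)),\dots,\tau(e_{\deg(v)}(v)))\in W$ for every $v\in V$; the problem is always solvable if every $\beta:N(v_0)\to C$ has a full extension. The brick Wang prototiles are $W_B=\{(c_1,c_2,c_3,c_4)\in C^4\mid (c_1=c_3\wedge c_2\ne c_4)\text{ or }(c_1\ne c_3\wedge c_2=c_4)\}$. Let $\bar G$ be the graph with vertex set $\mathbb{Z}\times\mathbb{Z}\cup\{v_0\}$ and edges between $(i,j),(i',j')$ with $|i-i'|+|j-j'|=1$, where $N((i,j))$ is ordered as the edges to $(i+1,j),(i,j+1),(i-1,j),(i,j-1)$. For a finite subgraph $(U,F)$ of the grid with $U$ nonempty and $(U,F)$ connected, the restriction has vertex set $U\cup\{v_0\}$ and edge set $F\cup\{(u,v_0)\mid u\in U,(u,v)\in E(\bar G)\setminus F\}$ (each removed edge at $u$ becomes an edge from $u$ to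 $v_0$ in the same position of the ordering of $N(u)$). A square grid board is such a restriction. A cycle is a sequence $(v_1,\dots,v_{l-1},v_l=v_1)$ of cells with $v_1,\dots,v_{l-1}$ distinct and consecutive cells joined by an edge.
   Formalization: A cycle is required to have at least three distinct cells (l ≥ 4); read literally, the definition also admits going back and forth along one edge (u,v,u), for which the claim fails on the board of two adjacent cells. *)

theory Defs
  imports Main "HOL-Library.FuncSet"
begin

text \<open>
  An undirected multigraph with a distinguished vertex \<open>outer\<close>. Edges are abstract names, and
  \<open>ends e\<close> is the set of endpoints of \<open>e\<close> (a singleton for a loop). The list \<open>nbrs v\<close> is the
  enumeration $e_1(v), \dots, e_{\deg(v)}(v)$; it is meaningful only for cells \<open>v\<close>.
\<close>

record ('v, 'e) board_graph =
  cells :: "'v set"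
  outer :: 'v
  edges :: "'e set"
  ends :: "'e \<Rightarrow> 'v set"
  nbrs :: "'v \<Rightarrow> 'e list"

definition incident_edges :: "('v, 'e) board_graph \<Rightarrow> 'v \<Rightarrow> 'e set" where
  "incident_edges G v = {e \<in> edges G. v \<in> ends G e}"

text \<open>Adjacency in the full subgraph on the set of cells.\<close>

definition cell_adj :: "('v, 'e) board_graph \<Rightarrow> 'v \<Rightarrow> 'v \<Rightarrow> bool" where
  "cell_adj G u v \<longleftrightarrow> u \<in> cells G \<and> v \<in> cells G \<and> (\<exists>e\<in>edges G. ends G e = {u, v})"

definition board :: "('v, 'e) board_graph \<Rightarrow> bool" where
  "board G \<longleftrightarrow>
     finite (cells G) \<and> finite (edges G) \<and> outer G \<notin> cells G \<and>
     (\<forall>e\<in>edges G. ends G e \<subseteq> insert (outer G) (cells G) \<and> card (ends G e) \<in> {1, 2}) \<and>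
     (\<forall>v\<in>cells G. distinct (nbrs G v) \<and> set (nbrs G v) = incident_edges G v) \<and>
     cells G \<noteq> {} \<and>
     (\<forall>u\<in>cells G. \<forall>v\<in>cells G. (cell_adj G)\<^sup>*\<^sup>* u v)"

text \<open>
  The closed sequence $(v_1, \dots, v_{l-1}, v_l = v_1)$ is given in full, and at least three
  distinct cells are required: otherwise $(u, v, u)$ would be a cycle for every edge \<open>uv\<close>.
  The definition ignores loops and parallel edges between cells, which do not occur in
  square grid boards.
\<close>

definition is_cycle :: "('v, 'e) board_graph \<Rightarrow> 'v list \<Rightarrow> bool" where
  "is_cycle G vs \<longleftrightarrow>
     4 \<le> length vs \<and> last vs = hd vs \<and> distinct (butlast vs) \<and>
     set vs \<subseteq> cells G \<and> successively (cell_adj G) vs"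

definition contains_cycle :: "('v, 'e) board_graph \<Rightarrow> bool" where
  "contains_cycle G \<longleftrightarrow> (\<exists>vs. is_cycle G vs)"

text \<open>Tiles are lists of colours, so that \<open>W :: 'c list set\<close> may mix tiles of different lengths.\<close>

definition full_extension ::
  "('v, 'e) board_graph \<Rightarrow> 'c set \<Rightarrow> 'c list set \<Rightarrow> ('e \<Rightarrow> 'c) \<Rightarrow> ('e \<Rightarrow> 'c) \<Rightarrow> bool" where
  "full_extension G C W \<beta> \<tau> \<longleftrightarrow>
     \<tau> \<in> edges G \<rightarrow> C \<and>
     (\<forall>e\<in>incident_edges G (outer G). \<tau> e = \<beta> e) \<and>
     (\<forall>v\<in>cells G. map \<tau> (nbrs G v) \<in> W)"

definition always_solvable :: "('v, 'e) board_graph \<Rightarrow> 'c set \<Rightarrow> 'c list set \<Rightarrow> bool" where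
  "always_solvable G C W \<longleftrightarrow>
     (\<forall>\<beta> \<in> incident_edges G (outer G) \<rightarrow> C. \<exists>\<tau>. full_extension G C W \<beta> \<tau>)"

definition brick_tiles :: "'c set \<Rightarrow> 'c list set" where
  "brick_tiles C =
     {[c1, c2, c3, c4] | c1 c2 c3 c4.
        c1 \<in> C \<and> c2 \<in> C \<and> c3 \<in> C \<and> c4 \<in> C \<and>
        (c1 = c3 \<and> c2 \<noteq> c4 \<or> c1 \<noteq> c3 \<and> c2 = c4)}"

type_synonym point = "int \<times> int"

definition grid_edges :: "point set set" where
  "grid_edges = {{(i, j), (i', j')} | i j i' j'. \<bar>i - i'\<bar> + \<bar>j - j'\<bar> = 1}"

fun grid_nbrs :: "point \<Rightarrow> point set list" where
  "grid_nbrs (i, j) =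
     [{(i, j), (i + 1, j)}, {(i, j), (i, j + 1)}, {(i, j), (i - 1, j)}, {(i, j), (i, j - 1)}]"

text \<open>
  Vertices of a restriction are \<open>Some p\<close> for points \<open>p\<close>, and \<open>None\<close> for $v_0$. An edge \<open>e\<close> of
  the grid outside \<open>F\<close> yields one edge \<open>Cut u e\<close> to $v_0$ for each endpoint \<open>u\<close> of \<open>e\<close> lying in
  \<open>U\<close>; thus if both endpoints lie in \<open>U\<close>, it yields two distinct edges, and several edges may join
  the same cell to $v_0$.
\<close>

datatype grid_edge = Kept "point set" | Cut point "point set"

definition grid_restriction ::
  "point set \<Rightarrow> point set set \<Rightarrow> (point option, grid_edge) board_graph" where
  "grid_restriction U F =
     \<lparr> cells = Some ` U,
       outer = None,
       edges = Kept ` F \<union> {Cut u e | u e. u \<in> U \<and> u \<in> e \<and> e \<in> grid_edges - F},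
       ends = (\<lambda>x. case x of Kept e \<Rightarrow> Some ` e | Cut u e \<Rightarrow> {Some u, None}),
       nbrs = (\<lambda>x. case x of
           None \<Rightarrow> []
         | Some u \<Rightarrow> map (\<lambda>e. if e \<in> F then Kept e else Cut u e) (grid_nbrs u)) \<rparr>"

definition finite_connected_grid_subgraph :: "point set \<Rightarrow> point set set \<Rightarrow> bool" where
  "finite_connected_grid_subgraph U F \<longleftrightarrow>
     finite U \<and> U \<noteq> {} \<and> F \<subseteq> {e \<in> grid_edges. e \<subseteq> U} \<and>
     (\<forall>u\<in>U. \<forall>v\<in>U. (\<lambda>p q. {p, q} \<in> F)\<^sup>*\<^sup>* u v)"

definition square_grid_board :: "(point option, grid_edge) board_graph \<Rightarrow> bool" where
  "square_grid_board G \<longleftrightarrow>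
     (\<exists>U F. finite_connected_grid_subgraph U F \<and> G = grid_restriction U F)"

lemma set_grid_nbrs: "set (grid_nbrs u) = {e \<in> grid_edges. u \<in> e}"
proof -
  obtain i j where u: "u = (i, j)" by (cases u)
  have "e \<in> set (grid_nbrs u)" if "e \<in> grid_edges" "u \<in> e" for e
  proof -
    obtain a b c d where e: "e = {(a, b), (c, d)}" and d: "\<bar>a - c\<bar> + \<bar>b - d\<bar> = 1"
      using \<open>e \<in> grid_edges\<close> by (auto simp: grid_edges_def)
    have "(i, j) = (a, b) \<or> (i, j) = (c, d)"
      using \<open>u \<in> e\<close> by (simp add: u e)
    then obtain p q where e': "e = {(i, j), (p, q)}" and "\<bar>i - p\<bar> + \<bar>j - q\<bar> = 1"
    proof
      assume "(i, j) = (a, b)"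
      then show ?thesis using that[of c d] e d by simp
    next
      assume "(i, j) = (c, d)"
      then show ?thesis using that[of a b] e d by (simp add: insert_commute abs_minus_commute)
    qed
    then have "p = i + 1 \<and> q = j \<or> p = i - 1 \<and> q = j \<or> p = i \<and> q = j + 1 \<or> p = i \<and> q = j - 1"
      by arith
    then show ?thesis
      unfolding e' u by (elim disjE conjE) simp_all
  qed
  moreover have "e \<in> grid_edges \<and> u \<in> e" if "e \<in> set (grid_nbrs u)" for e
  proof -
    have "{(i, j), (a, b)} \<in> grid_edges" if "\<bar>i - a\<bar> + \<bar>j - b\<bar> = 1" for a b
      using that unfolding grid_edges_def by blast
    then show ?thesis
      using that by (auto simp: u)
  qed
  ultimately show ?thesis by blast
qed

lemma distinct_grid_nbrs: "distinct (grid_nbrs u)"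
  by (cases u) (auto simp: doubleton_eq_iff)

lemma square_grid_board_imp_board:
  assumes "square_grid_board G"
  shows "board G"
proof -
  obtain U F where UF: "finite_connected_grid_subgraph U F" and G: "G = grid_restriction U F"
    using assms by (auto simp: square_grid_board_def)
  have fin: "finite U" and ne: "U \<noteq> {}" and F: "F \<subseteq> {e \<in> grid_edges. e \<subseteq> U}"
    and conn: "\<And>u v. u \<in> U \<Longrightarrow> v \<in> U \<Longrightarrow> (\<lambda>p q. {p, q} \<in> F)\<^sup>*\<^sup>* u v"
    using UF by (auto simp: finite_connected_grid_subgraph_def)
  have card2: "card e = 2" if "e \<in> grid_edges" for e
    using that by (auto simp: grid_edges_def card_insert_if)
  have "finite F"
    using fin F by (auto intro: finite_subset[of _ "Pow U"])
  moreover have "{Cut u e | u e. u \<in> U \<and> u \<in> e \<and> e \<in> grid_edges - F}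
      \<subseteq> (\<Union>u\<in>U. Cut u ` set (grid_nbrs u))"
    by (auto simp: set_grid_nbrs)
  then have "finite {Cut u e | u e. u \<in> U \<and> u \<in> e \<and> e \<in> grid_edges - F}"
    using fin by (rule_tac finite_subset) auto
  ultimately have finE: "finite (edges G)"
    by (simp add: G grid_restriction_def)
  have ends: "ends G e \<subseteq> insert (outer G) (cells G) \<and> card (ends G e) \<in> {1, 2}"
    if "e \<in> edges G" for e
    using that
  proof (cases e)
    case (Kept f)
    then have "f \<in> F"
      using that by (auto simp: G grid_restriction_def)
    then have "f \<in> grid_edges" "f \<subseteq> U"
      using F by auto
    then show ?thesis
      using card2 Kept by (auto simp: G grid_restriction_def card_image)
  next
    case (Cut u f)
    then show ?thesis
      using that by (auto simp: G grid_restriction_def)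
  qed
  have nbrs: "distinct (nbrs G v) \<and> set (nbrs G v) = incident_edges G v" if "v \<in> cells G" for v
  proof -
    obtain u where u: "v = Some u" "u \<in> U"
      using \<open>v \<in> cells G\<close> by (auto simp: G grid_restriction_def)
    have "distinct (nbrs G v)"
      using distinct_grid_nbrs[of u]
      by (auto simp: G grid_restriction_def u distinct_map inj_on_def split: if_splits)
    moreover have "set (nbrs G v) = incident_edges G v"
    proof -
      have "set (nbrs G v) = (\<lambda>e. if e \<in> F then Kept e else Cut u e) ` {e \<in> grid_edges. u \<in> e}"
        by (simp add: G grid_restriction_def u flip: set_grid_nbrs)
      also have "\<dots> = Kept ` {e \<in> F. u \<in> e} \<union> Cut u ` {e \<in> grid_edges - F. u \<in> e}"
        using F by auto
      also have "\<dots> = incident_edges G v"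
        using u(2) unfolding incident_edges_def
        by (auto simp: G grid_restriction_def u(1) simp del: split_paired_Ex split_paired_All)
      finally show ?thesis .
    qed
    ultimately show ?thesis ..
  qed
  have adj: "cell_adj G (Some p) (Some q)" if "{p, q} \<in> F" for p q
    using that F by (auto simp: cell_adj_def G grid_restriction_def intro!: bexI[of _ "Kept {p, q}"])
  have "(cell_adj G)\<^sup>*\<^sup>* (Some u) (Some v)" if "(\<lambda>p q. {p, q} \<in> F)\<^sup>*\<^sup>* u v" for u v
    using that by induction (auto intro: adj rtranclp.rtrancl_into_rtrancl)
  then have "\<forall>u\<in>cells G. \<forall>v\<in>cells G. (cell_adj G)\<^sup>*\<^sup>* u v"
    using conn by (auto simp: G grid_restriction_def)
  then show ?thesis
    using fin ne finE ends nbrs unfolding board_def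
    by (auto simp: G grid_restriction_def)
qed

end

theory Submission
  imports Defs "HOL-Library.Product_Plus"
begin

text \<open>
  If a cell's sides are all coloured but one, the last side can always be coloured legally, and
  if the two sides perpendicular to it have different colours, its colour is forced to be
  that of the opposite side. Without cycles, one can remove cells with at most one remaining
  neighbour one by one; running backwards through this order, the boundary colours can be chosen
  such that all inner colours are forced and the last cell violates its constraint.

  If there is a cycle, all cells outside it can be satisfied by working towards the cycle, and it
  remains to colour the edges of the cycle. Going once around it, the set of colours reachable
  from a given start colour is always a singleton, the complement of a singleton, or everything.
  As the number of corners is even, some colour is reachable from itself.
\<close>

section \<open>Sides of a cell\<close>

definition dirs :: "point set" where
  "dirs = {(1, 0), (0, 1), (-1, 0), (0, -1)}"

definition rot :: "point \<Rightarrow> point" where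
  "rot d = (- snd d, fst d)"

text \<open>A kept edge has one name shared by both its ends, while a removed edge between two cells
  has a separate name at each end.\<close>

definition side :: "point set set \<Rightarrow> point \<Rightarrow> point \<Rightarrow> grid_edge" where
  "side F u d = (if {u, u + d} \<in> F then Kept {u, u + d} else Cut u {u, u + d})"

text \<open>This is \<open>brick_tiles\<close> without the condition that the colours lie in
  \<open>C\<close>; its two disjuncts combine into an exclusive or.\<close>

definition brick_at :: "point set set \<Rightarrow> (grid_edge \<Rightarrow> 'c) \<Rightarrow> point \<Rightarrow> bool" where
  "brick_at F \<tau> u \<longleftrightarrow>
     (\<tau> (side F u (1, 0)) = \<tau> (side F u (-1, 0))) \<noteq> (\<tau> (side F u (0, 1)) = \<tau> (side F u (0, -1)))"

text \<open>The condition is symmetric under quarter turns, so later arguments can choose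
  \<open>d\<close> along the edge of interest.\<close>

lemma brick_at_dir:
  assumes "d \<in> dirs"
  shows "brick_at F \<tau> u \<longleftrightarrow>
    (\<tau> (side F u d) = \<tau> (side F u (- d))) \<noteq> (\<tau> (side F u (rot d)) = \<tau> (side F u (- rot d)))"
  using assms unfolding dirs_def brick_at_def rot_def by auto

lemma dirs_cases:
  assumes "d \<in> dirs" "d' \<in> dirs"
  shows "d' = d \<or> d' = - d \<or> d' = rot d \<or> d' = - rot d"
  using assms by (auto simp: dirs_def rot_def)

lemma dirs_closed:
  assumes "d \<in> dirs"
  shows "- d \<in> dirs" "rot d \<in> dirs" "- rot d \<in> dirs"
  using assms by (auto simp: dirs_def rot_def)

lemma dirs_distinct:
  assumes "d \<in> dirs"
  shows "d \<noteq> 0" "- d \<noteq> d" "rot d \<noteq> d" "rot d \<noteq> - d" "- rot d \<noteq> d" "- rot d \<noteq> - d"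
    "- rot d \<noteq> rot d"
  using assms by (auto simp: dirs_def rot_def zero_prod_def)

text \<open>A \<open>Cut\<close> records its cell, so only a \<open>Kept\<close> edge can be a side
  of two cells, seen from them in opposite directions.\<close>

lemma side_eq_iff:
  "side F u d = side F w d' \<longleftrightarrow>
     u = w \<and> d = d' \<or> w = u + d \<and> d' = - d \<and> {u, w} \<in> F"
  by (cases u; cases w; cases d; cases d')
    (auto simp: side_def doubleton_eq_iff insert_commute split: if_splits)

lemma side_inj: "side F u d = side F u d' \<longleftrightarrow> d = d'"
  by (auto simp: side_eq_iff)

lemma grid_edge_dir:
  assumes "{u, w} \<in> grid_edges"
  shows "w - u \<in> dirs"
proof -
  have "{u, w} \<in> set (grid_nbrs u)"
    using assms by (simp add: set_grid_nbrs)
  then show ?thesis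
    by (cases u; cases w) (auto simp: dirs_def doubleton_eq_iff)
qed

lemma dir_grid_edge:
  assumes "d \<in> dirs"
  shows "{u, u + d} \<in> grid_edges"
proof -
  have "{u, u + d} \<in> set (grid_nbrs u)"
    using assms unfolding dirs_def by (cases u) (elim insertE emptyE; simp)
  then show ?thesis by (simp add: set_grid_nbrs)
qed

section \<open>Restrictions expressed through sides\<close>

lemma grid_nbrs_side:
  "map (\<lambda>e. if e \<in> F then Kept e else Cut u e) (grid_nbrs u) =
     map (side F u) [(1, 0), (0, 1), (-1, 0), (0, -1)]"
  by (cases u) (simp add: side_def)

lemma cells_grid_restriction: "cells (grid_restriction U F) = Some ` U"
  by (simp add: grid_restriction_def)

lemma side_in_edges:
  assumes "u \<in> U" "d \<in> dirs"
  shows "side F u d \<in> edges (grid_restriction U F)"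
proof -
  have "{u, u + d} \<in> grid_edges" using assms by (simp add: dir_grid_edge)
  then show ?thesis
    using \<open>u \<in> U\<close> unfolding side_def grid_restriction_def
    by (auto simp del: split_paired_Ex)
qed

lemma incident_edges_outer:
  "incident_edges (grid_restriction U F) (outer (grid_restriction U F)) =
     {Cut u e | u e. u \<in> U \<and> u \<in> e \<and> e \<in> grid_edges - F}"
  by (auto simp: incident_edges_def grid_restriction_def)

text \<open>All four sides of a cell are edges of the restriction, so for a colouring into
  \<open>C\<close> only the comparisons of colours remain to be checked.\<close>

lemma full_extension_grid_restriction:
  "full_extension (grid_restriction U F) C (brick_tiles C) \<beta> \<tau> \<longleftrightarrow>
     \<tau> \<in> edges (grid_restriction U F) \<rightarrow> C \<and>
     (\<forall>e\<in>incident_edges (grid_restriction U F) (outer (grid_restriction U F)). \<tau> e = \<beta> e) \<and>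
     (\<forall>u\<in>U. brick_at F \<tau> u)"
proof -
  have "map \<tau> (nbrs (grid_restriction U F) (Some u)) \<in> brick_tiles C \<longleftrightarrow> brick_at F \<tau> u"
    if "\<tau> \<in> edges (grid_restriction U F) \<rightarrow> C" "u \<in> U" for u
  proof -
    have "\<tau> (side F u d) \<in> C" if "d \<in> dirs" for d
      using side_in_edges[OF \<open>u \<in> U\<close> that, of F] \<open>\<tau> \<in> _\<close> by blast
    then have "\<tau> (side F u (1, 0)) \<in> C" "\<tau> (side F u (0, 1)) \<in> C"
      "\<tau> (side F u (-1, 0)) \<in> C" "\<tau> (side F u (0, -1)) \<in> C"
      by (simp_all add: dirs_def)
    moreover have "nbrs (grid_restriction U F) (Some u) =
        map (side F u) [(1, 0), (0, 1), (-1, 0), (0, -1)]"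
      using grid_nbrs_side[of F u] by (simp add: grid_restriction_def)
    ultimately show ?thesis
      by (simp add: brick_tiles_def brick_at_def) blast
  qed
  then show ?thesis
    unfolding full_extension_def by (auto simp: cells_grid_restriction)
qed

lemma cell_adj_grid_restriction:
  assumes "F \<subseteq> {e \<in> grid_edges. e \<subseteq> U}"
  shows "cell_adj (grid_restriction U F) (Some p) (Some q) \<longleftrightarrow> {p, q} \<in> F"
proof
  assume "cell_adj (grid_restriction U F) (Some p) (Some q)"
  then obtain e where "e \<in> F" "Some ` e = Some ` {p, q}"
    by (auto simp: cell_adj_def grid_restriction_def doubleton_eq_iff)
  then show "{p, q} \<in> F"
    by (metis inj_Some inj_image_eq_iff)
next
  assume "{p, q} \<in> F"
  then show "cell_adj (grid_restriction U F) (Some p) (Some q)"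
    using assms
    by (auto simp: cell_adj_def grid_restriction_def intro!: bexI[of _ "Kept {p, q}"])
qed

section \<open>Boards without cycles\<close>

text \<open>All neighbours of the first vertex of a longest path lie on the path, as otherwise it
  could be prolonged at the front.\<close>

lemma cycle_if_min_degree_2:
  assumes "finite T" "T \<noteq> {}"
    and sym: "\<And>x y. A x y \<Longrightarrow> A y x" and irrefl: "\<And>x. \<not> A x x"
    and deg: "\<And>x. x \<in> T \<Longrightarrow> \<exists>y\<in>T. \<exists>z\<in>T. y \<noteq> z \<and> A x y \<and> A x z"
  shows "\<exists>vs. 4 \<le> length vs \<and> last vs = hd vs \<and> distinct (butlast vs) \<and> set vs \<subseteq> T \<and>
    successively A vs"
proof -
  let ?P = "\<lambda>xs. xs \<noteq> [] \<and> set xs \<subseteq> T \<and> distinct xs \<and> successively A xs"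
  obtain t where "t \<in> T" using \<open>T \<noteq> {}\<close> by blast
  then have "?P [t]" by simp
  moreover have "\<forall>xs. ?P xs \<longrightarrow> length xs < Suc (card T)"
    using \<open>finite T\<close> by (metis card_mono distinct_card less_Suc_eq_le)
  ultimately obtain xs where xs: "?P xs" and max: "\<And>ys. ?P ys \<Longrightarrow> length ys \<le> length xs"
    using ex_has_greatest_nat[of ?P "[t]" length "Suc (card T)"] by blast
  then obtain v ys where v: "xs = v # ys" by (cases xs) auto
  then have "v \<in> T" using xs by simp
  then obtain y z where yz: "y \<in> T" "z \<in> T" "y \<noteq> z" "A v y" "A v z"
    using deg by blast
  have in_ys: "w \<in> set ys" if "w \<in> T" "A v w" for w
  proof (rule ccontr)
    assume "w \<notin> set ys"
    moreover have "w \<noteq> v" using that irrefl by blast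
    ultimately have "?P (w # xs)"
      using that xs sym by (auto simp: v successively_Cons)
    then show False using max by fastforce
  qed
  \<comment> \<open>One of two neighbours of \<open>v\<close> differs from the second vertex of the
    path. This makes \<open>as\<close> nonempty, so the cycle closed by \<open>w\<close> has at
    least three distinct vertices.\<close>
  obtain w where w: "w \<in> set ys" "A v w" "w \<noteq> hd ys" "w \<in> T"
    using yz in_ys by metis
  then obtain as bs where ys: "ys = as @ w # bs" by (meson split_list)
  then have "as \<noteq> []" using w by auto
  let ?vs = "v # as @ [w, v]"
  have "successively A ?vs"
    using xs sym w(2) \<open>as \<noteq> []\<close> unfolding v ys
    by (auto simp: successively_Cons successively_append_iff)
  moreover have "distinct (butlast ?vs)" "set ?vs \<subseteq> T"
    using xs unfolding v ys by (auto simp: butlast_append)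
  moreover have "4 \<le> length ?vs" "last ?vs = hd ?vs"
    using \<open>as \<noteq> []\<close> by (cases as; simp)+
  ultimately show ?thesis by blast
qed

text \<open>Induction on the size of \<open>S\<close>, peeling off a cell \<open>v\<close> with at
  most one neighbour left in \<open>S\<close>. Only the values of \<sigma> on sides leaving
  \<open>S\<close> matter; at \<open>v\<close> they force its remaining side to the colour
  prescribed there by the bad colouring of \<open>S - {v}\<close>.\<close>

lemma forced_colouring:
  assumes "finite S" "S \<noteq> {}"
    and F: "F \<subseteq> grid_edges"
    and peel: "\<And>T. T \<subseteq> S \<Longrightarrow> T \<noteq> {} \<Longrightarrow>
      \<exists>v\<in>T. \<forall>y\<in>T. \<forall>z\<in>T. {v, y} \<in> F \<longrightarrow> {v, z} \<in> F \<longrightarrow> y = z"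
    and ab: "a \<in> C" "b \<in> C" "a \<noteq> b"
  shows "\<exists>\<sigma>. range \<sigma> \<subseteq> C \<and>
    (\<forall>\<tau>. (\<forall>u\<in>S. \<forall>d\<in>dirs. {u, u + d} \<in> F \<and> u + d \<in> S \<or> \<tau> (side F u d) = \<sigma> (side F u d)) \<longrightarrow>
      \<not> (\<forall>u\<in>S. brick_at F \<tau> u))"
  using assms(1,2) peel
proof (induction "card S" arbitrary: S)
  case 0
  then show ?case by simp
next
  case (Suc n)
  obtain v where v: "v \<in> S"
    and uniq: "\<And>y z. y \<in> S \<Longrightarrow> z \<in> S \<Longrightarrow> {v, y} \<in> F \<Longrightarrow> {v, z} \<in> F \<Longrightarrow> y = z"
    using Suc.prems(3)[of S] \<open>S \<noteq> {}\<close> by blast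
  define S' where "S' = S - {v}"
  show ?case
  proof (cases "S' = {}")
    case True
    then have S: "S = {v}" using v S'_def by blast
    have "\<not> brick_at F \<tau> v"
      if "\<forall>u\<in>S. \<forall>d\<in>dirs. {u, u + d} \<in> F \<and> u + d \<in> S \<or> \<tau> (side F u d) = a" for \<tau>
    proof -
      have "\<tau> (side F v d) = a" if "d \<in> dirs" for d
        using \<open>\<forall>u\<in>S. _\<close> S that dirs_distinct(1)[OF that] by auto
      then show ?thesis by (simp add: brick_at_def dirs_def)
    qed
    then show ?thesis
      using ab by (intro exI[of _ "\<lambda>_. a"]) (auto simp: S)
  next
    case False
    have peel': "\<exists>v\<in>T. \<forall>y\<in>T. \<forall>z\<in>T. {v, y} \<in> F \<longrightarrow> {v, z} \<in> F \<longrightarrow> y = z"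
      if "T \<subseteq> S'" "T \<noteq> {}" for T
      using Suc.prems(3)[of T] that unfolding S'_def by blast
    have "n = card S'" "finite S'"
      using Suc.hyps(2) Suc.prems(1) v by (auto simp: S'_def)
    then obtain \<sigma> where \<sigma>: "range \<sigma> \<subseteq> C" and
      "\<forall>\<tau>. (\<forall>u\<in>S'. \<forall>d\<in>dirs. {u, u + d} \<in> F \<and> u + d \<in> S' \<or> \<tau> (side F u d) = \<sigma> (side F u d)) \<longrightarrow>
        \<not> (\<forall>u\<in>S'. brick_at F \<tau> u)"
      using Suc.hyps(1)[OF _ _ False peel'] by blast
    then have no_brick: "False"
      if "\<And>u d. \<lbrakk>u \<in> S'; d \<in> dirs; \<not> ({u, u + d} \<in> F \<and> u + d \<in> S')\<rbrakk> \<Longrightarrow>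
          \<tau> (side F u d) = \<sigma> (side F u d)" "\<And>u. u \<in> S' \<Longrightarrow> brick_at F \<tau> u" for \<tau>
      using that by blast
    \<comment> \<open>\<open>d0\<close> points to the only neighbour of \<open>v\<close> in
      \<open>S\<close>; if there is none, any direction serves.\<close>
    obtain d0 where d0: "d0 \<in> dirs"
      and d0_uniq: "\<And>d. d \<in> dirs \<Longrightarrow> {v, v + d} \<in> F \<Longrightarrow> v + d \<in> S \<Longrightarrow> d = d0"
    proof (cases "\<exists>d\<in>dirs. {v, v + d} \<in> F \<and> v + d \<in> S")
      case True
      then obtain d where d: "d \<in> dirs" "{v, v + d} \<in> F" "v + d \<in> S" by blast
      show ?thesis
        by (rule that[OF d(1)]) (metis uniq d(2,3) add_left_cancel)
    next
      case False
      have "(1, 0) \<in> dirs" by (simp add: dirs_def)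
      then show ?thesis using False that by blast
    qed
    \<comment> \<open>Different colours on the perpendicular sides force the \<open>d0\<close> side
      to repeat the opposite one, which is given the colour that \<sigma> wants on the
      \<open>d0\<close> side.\<close>
    define \<sigma>' where "\<sigma>' = \<sigma>(side F v (- d0) := \<sigma> (side F v d0),
      side F v (rot d0) := a, side F v (- rot d0) := b)"
    have "range \<sigma>' \<subseteq> C"
      using \<sigma> ab by (auto simp: \<sigma>'_def)
    moreover have False
      if bd: "\<forall>u\<in>S. \<forall>d\<in>dirs. {u, u + d} \<in> F \<and> u + d \<in> S \<or> \<tau> (side F u d) = \<sigma>' (side F u d)"
        and brick: "\<forall>u\<in>S. brick_at F \<tau> u" for \<tau>
    proof (rule no_brick[of \<tau>])
      show "brick_at F \<tau> u" if "u \<in> S'" for u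
        using brick that by (simp add: S'_def)
      have \<tau>v: "\<tau> (side F v d) = \<sigma>' (side F v d)" if "d \<in> dirs" "d \<noteq> d0" for d
        using bd v d0_uniq that by blast
      note D = dirs_closed[OF d0] dirs_distinct[OF d0]
      have "\<tau> (side F v (- d0)) = \<sigma> (side F v d0)" "\<tau> (side F v (rot d0)) = a"
        "\<tau> (side F v (- rot d0)) = b"
        using \<tau>v D D(4-)[symmetric] by (simp_all add: \<sigma>'_def side_inj)
      then have forced: "\<tau> (side F v d0) = \<sigma> (side F v d0)"
        using brick v brick_at_dir[OF d0, of F \<tau> v] ab(3) by simp
      \<comment> \<open>A side leaving \<open>S'\<close> either faces \<open>v\<close> and is the
        forced one, or already leaves \<open>S\<close> and is not a side of \<open>v\<close>, so
        that \<open>\<sigma>'\<close> agrees with \<sigma> there.\<close>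
      show "\<tau> (side F u d) = \<sigma> (side F u d)"
        if u: "u \<in> S'" and d: "d \<in> dirs" and out: "\<not> ({u, u + d} \<in> F \<and> u + d \<in> S')" for u d
      proof (cases "{u, u + d} \<in> F \<and> u + d = v")
        case True
        then have "{v, v + (- d)} \<in> F" "v + (- d) \<in> S"
          using u by (auto simp: S'_def insert_commute)
        then have "- d = d0" using d0_uniq dirs_closed(1)[OF d] by blast
        then have "side F u d = side F v d0"
          using True by (auto simp: side_eq_iff)
        then show ?thesis using forced by simp
      next
        case False
        then have "\<tau> (side F u d) = \<sigma>' (side F u d)"
          using bd u d out by (auto simp: S'_def)
        moreover have "side F u d \<noteq> side F v d'" for d'
          using u False by (auto simp: side_eq_iff S'_def)
        ultimately show ?thesis by (simp add: \<sigma>'_def)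
      qed
    qed
    ultimately show ?thesis by blast
  qed
qed

text \<open>Absence of cycles gives the peeling hypothesis of \<open>forced_colouring\<close> via
  \<open>cycle_if_min_degree_2\<close>. The sides leaving \<open>U\<close> are edges to the outer
  vertex, so the resulting colouring is a boundary condition without full extension.\<close>

lemma contains_cycle_if_always_solvable:
  assumes UF: "finite_connected_grid_subgraph U F"
    and ab: "a \<in> C" "b \<in> C" "a \<noteq> b"
    and solv: "always_solvable (grid_restriction U F) C (brick_tiles C)"
  shows "contains_cycle (grid_restriction U F)"
proof (rule ccontr)
  let ?G = "grid_restriction U F"
  assume no_cycle: "\<not> contains_cycle ?G"
  have fin: "finite U" and ne: "U \<noteq> {}" and F: "F \<subseteq> {e \<in> grid_edges. e \<subseteq> U}"
    using UF by (auto simp: finite_connected_grid_subgraph_def)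
  have "\<exists>v\<in>T. \<forall>y\<in>T. \<forall>z\<in>T. {v, y} \<in> F \<longrightarrow> {v, z} \<in> F \<longrightarrow> y = z"
    if "T \<subseteq> U" "T \<noteq> {}" for T
  proof (rule ccontr)
    assume neg: "\<not> ?thesis"
    have "\<exists>vs. 4 \<le> length vs \<and> last vs = hd vs \<and> distinct (butlast vs) \<and> set vs \<subseteq> T \<and>
        successively (\<lambda>x y. {x, y} \<in> F) vs"
    proof (rule cycle_if_min_degree_2)
      show "finite T" "T \<noteq> {}" using that fin finite_subset by auto
      show "{y, x} \<in> F" if "{x, y} \<in> F" for x y
        using that by (simp add: insert_commute)
      show "{x, x} \<notin> F" for x
        using F grid_edge_dir[of x x] by (auto simp: dirs_def zero_prod_def)
      show "\<exists>y\<in>T. \<exists>z\<in>T. y \<noteq> z \<and> {x, y} \<in> F \<and> {x, z} \<in> F" if "x \<in> T" for x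
        using neg that by blast
    qed
    then obtain vs where vs: "4 \<le> length vs" "last vs = hd vs" "distinct (butlast vs)"
      "set vs \<subseteq> T" "successively (\<lambda>x y. {x, y} \<in> F) vs"
      by blast
    then have "last (map Some vs) = hd (map Some vs)" by (cases "vs = []") (simp_all add: last_map hd_map)
    with vs have "is_cycle ?G (map Some vs)"
      using \<open>T \<subseteq> U\<close> unfolding is_cycle_def
      by (auto simp: map_butlast[symmetric] distinct_map successively_map
          cell_adj_grid_restriction[OF F] cells_grid_restriction)
    then show False using no_cycle contains_cycle_def by blast
  qed
  then obtain \<sigma> where \<sigma>: "range \<sigma> \<subseteq> C" and
    no_brick: "\<And>\<tau>. \<forall>u\<in>U. \<forall>d\<in>dirs. {u, u + d} \<in> F \<and> u + d \<in> U \<or>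
      \<tau> (side F u d) = \<sigma> (side F u d) \<Longrightarrow> \<not> (\<forall>u\<in>U. brick_at F \<tau> u)"
    using forced_colouring[OF fin ne _ _ ab, of F] F by blast
  have "\<sigma> \<in> incident_edges ?G (outer ?G) \<rightarrow> C" using \<sigma> by blast
  then obtain \<tau> where \<tau>: "full_extension ?G C (brick_tiles C) \<sigma> \<tau>"
    using solv always_solvable_def by blast
  have "{u, u + d} \<in> F \<and> u + d \<in> U \<or> \<tau> (side F u d) = \<sigma> (side F u d)"
    if "u \<in> U" "d \<in> dirs" for u d
  proof (cases "{u, u + d} \<in> F")
    case True
    then show ?thesis using F by auto
  next
    case False
    then have "side F u d \<in> incident_edges ?G (outer ?G)"
      using that dir_grid_edge[of d u]
      by (auto simp: incident_edges_outer side_def simp del: split_paired_Ex)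
    then show ?thesis using \<tau> by (simp add: full_extension_grid_restriction)
  qed
  then have "\<not> (\<forall>u\<in>U. brick_at F \<tau> u)" by (intro no_brick ballI)
  then show False using \<tau> by (simp add: full_extension_grid_restriction)
qed

section \<open>Boards with a cycle\<close>

primrec reach :: "'c set \<Rightarrow> (nat \<Rightarrow> 'c \<Rightarrow> 'c \<Rightarrow> bool) \<Rightarrow> nat \<Rightarrow> 'c \<Rightarrow> 'c set" where
  "reach C R 0 x = {x}"
| "reach C R (Suc k) x = {y \<in> C. \<exists>z\<in>reach C R k x. R k z y}"

text \<open>Here \<open>R k\<close> is the constraint between the colours of edge \<open>k\<close>
  and the next edge; tracing predecessors back yields an actual colour sequence.\<close>

lemma reach_walk:
  assumes "y \<in> reach C R k x" "x \<in> C"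
  shows "\<exists>f. f 0 = x \<and> f k = y \<and> (\<forall>i\<le>k. f i \<in> C) \<and> (\<forall>i<k. R i (f i) (f (Suc i)))"
  using assms
proof (induction k arbitrary: y)
  case 0
  then show ?case by auto
next
  case (Suc k)
  then obtain z where z: "z \<in> reach C R k x" "R k z y" "y \<in> C" by auto
  then obtain f where "f 0 = x \<and> f k = z \<and> (\<forall>i\<le>k. f i \<in> C) \<and> (\<forall>i<k. R i (f i) (f (Suc i)))"
    using Suc by blast
  then show ?case
    using z by (intro exI[of _ "f(Suc k := y)"]) (auto simp: less_Suc_eq le_Suc_eq)
qed

text \<open>
  \<open>h i\<close> tells whether the \<open>i\<close>-th edge of the cycle is horizontal, so that it changes precisely at
  the corners. The case distinction in the proof is an invariant of the reachable sets; the first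
  two alternatives are only possible before the first corner.
\<close>

lemma closed_walk:
  fixes C :: "'c set" and h :: "nat \<Rightarrow> bool"
  assumes "C \<noteq> {}" and third: "\<And>x y. \<exists>z\<in>C. z \<noteq> x \<and> z \<noteq> y"
    and straight: "\<And>i. i < n \<Longrightarrow> h (Suc i) = h i \<Longrightarrow> R i = (=) \<or> R i = (\<noteq>)"
    and corner: "\<And>i. i < n \<Longrightarrow> h (Suc i) \<noteq> h i \<Longrightarrow>
      \<exists>c\<in>C. \<exists>d\<in>C. R i = (\<lambda>x y. (x = c) \<noteq> (y = d))"
    and closed: "h n = h 0" and ex_corner: "\<exists>i<n. h (Suc i) \<noteq> h i"
  shows "\<exists>f. f n = f 0 \<and> (\<forall>i\<le>n. f i \<in> C) \<and> (\<forall>i<n. R i (f i) (f (Suc i)))"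
proof -
  let ?A = "reach C R"
  have step: "?A (Suc k) x = {y \<in> C. \<exists>z\<in>?A k x. R k z y}" for k x by simp
  \<comment> \<open>At a corner, \<open>c\<close> reaches every colour except \<open>d\<close>, and
    any other colour reaches \<open>d\<close>.\<close>
  have full: "?A (Suc k) x = C" if "k < n" "?A k x = C" for k x
  proof (cases "h (Suc k) = h k")
    case True
    then show ?thesis
      using straight[OF \<open>k < n\<close> True] \<open>?A k x = C\<close> third by (auto simp del: reach.simps simp: step) metis+
  next
    case False
    then obtain c d where "c \<in> C" "d \<in> C" "R k = (\<lambda>x y. (x = c) \<noteq> (y = d))"
      using corner[OF \<open>k < n\<close>] by blast
    then show ?thesis
      using that third[of c c] by (auto simp: step)
  qed
  have no_corner: "h k = h 0" if "\<forall>i<k. h (Suc i) = h i" for k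
    using that by (induction k) auto
  \<comment> \<open>In the third and fourth alternatives the start colour \<open>c\<close> is
    exceptional, and each corner exchanges singletons and complements; \<open>h k = h 0\<close>
    records that the number of corners so far is even.\<close>
  have inv: "(\<forall>i<k. h (Suc i) = h i) \<and> (\<forall>x\<in>C. ?A k x = {x})
      \<or> (\<forall>i<k. h (Suc i) = h i) \<and> (\<forall>x\<in>C. ?A k x = C - {x})
      \<or> h k = h 0 \<and> (\<exists>c\<in>C. \<exists>d\<in>C. ?A k c = {d} \<and> (\<forall>x\<in>C - {c}. ?A k x = C - {d}))
      \<or> h k \<noteq> h 0 \<and> (\<exists>c\<in>C. \<exists>d\<in>C. ?A k c = C - {d} \<and> (\<forall>x\<in>C - {c}. ?A k x = {d}))
      \<or> (\<exists>x\<in>C. ?A k x = C)" (is "?I k") if "k \<le> n" for k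
    using that
  proof (induction k)
    case 0
    then show ?case by simp
  next
    case (Suc k)
    then have k: "k < n" and IH: "?I k" by simp_all
    have single: "?A (Suc k) x = {y \<in> C. R k d y}" if "?A k x = {d}" for x d
      using that by (simp add: step)
    have cosingle_E: "?A (Suc k) x = C - {d}" if "?A k x = C - {d}" "R k = (=)" for x d
      using that by (auto simp: step)
    have cosingle_N: "?A (Suc k) x = C" if "?A k x = C - {d}" "R k = (\<noteq>)" for x d
      using that third[of d] by (auto simp: step)
    have cosingle_same: "?A (Suc k) x = {d'}"
      if "?A k x = C - {c'}" "R k = (\<lambda>x y. (x = c') \<noteq> (y = d'))" "d' \<in> C" for x c' d'
      using that third[of c' c'] by (auto simp: step)
    \<comment> \<open>The colour \<open>c'\<close> reaches everything but \<open>d'\<close>, and a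
      third colour besides \<open>d\<close> and \<open>c'\<close> reaches \<open>d'\<close>.\<close>
    have cosingle_diff: "?A (Suc k) x = C"
      if "?A k x = C - {d}" "R k = (\<lambda>x y. (x = c') \<noteq> (y = d'))" "c' \<in> C" "d \<noteq> c'" for x d c' d'
      using that third[of d c'] by (auto simp: step)
    have other: "\<exists>x\<in>C. x \<noteq> c" for c using third by blast
    have turn: "h (Suc k) = h k \<and> R k = (=) \<or> h (Suc k) = h k \<and> R k = (\<noteq>) \<or>
      h (Suc k) \<noteq> h k \<and> (\<exists>c\<in>C. \<exists>d\<in>C. R k = (\<lambda>x y. (x = c) \<noteq> (y = d)))"
      using straight[OF k] corner[OF k] by blast
    consider
      (eq) "\<forall>i<k. h (Suc i) = h i" "\<forall>x\<in>C. ?A k x = {x}"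
      | (neq) "\<forall>i<k. h (Suc i) = h i" "\<forall>x\<in>C. ?A k x = C - {x}"
      | (even) c d where "h k = h 0" "c \<in> C" "d \<in> C" "?A k c = {d}" "\<forall>x\<in>C - {c}. ?A k x = C - {d}"
      | (odd) c d where "h k \<noteq> h 0" "c \<in> C" "d \<in> C" "?A k c = C - {d}" "\<forall>x\<in>C - {c}. ?A k x = {d}"
      | (all) x where "x \<in> C" "?A k x = C"
      using IH by (elim disjE conjE bexE) (rule that; assumption)+
    then show ?case
    proof cases
      case eq
      from turn show ?thesis
      proof (elim disjE conjE bexE)
        assume "h (Suc k) = h k" "R k = (=)"
        then have "\<forall>i<Suc k. h (Suc i) = h i" "\<forall>x\<in>C. ?A (Suc k) x = {x}"
          using eq single by (auto simp: less_Suc_eq)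
        then show ?thesis by blast
      next
        assume "h (Suc k) = h k" "R k = (\<noteq>)"
        then have "\<forall>i<Suc k. h (Suc i) = h i" "\<forall>x\<in>C. ?A (Suc k) x = C - {x}"
          using eq single by (auto simp: less_Suc_eq)
        then show ?thesis by blast
      next
        fix c d
        assume "h (Suc k) \<noteq> h k" "c \<in> C" "d \<in> C" "R k = (\<lambda>x y. (x = c) \<noteq> (y = d))"
        moreover have "h k = h 0"
          using eq(1) by (rule no_corner)
        ultimately have "h (Suc k) \<noteq> h 0" "?A (Suc k) c = C - {d}" "\<forall>x\<in>C - {c}. ?A (Suc k) x = {d}"
          using eq(2) single by auto
        then show ?thesis using \<open>c \<in> C\<close> \<open>d \<in> C\<close> by blast
      qed
    next
      case neq
      from turn show ?thesis
      proof (elim disjE conjE bexE)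
        assume "h (Suc k) = h k" "R k = (=)"
        then have "\<forall>x\<in>C. ?A (Suc k) x = C - {x}" "\<forall>i<Suc k. h (Suc i) = h i"
          using neq cosingle_E by (auto simp: less_Suc_eq simp del: reach.simps)
        then show ?thesis by blast
      next
        assume "R k = (\<noteq>)"
        then have "\<exists>x\<in>C. ?A (Suc k) x = C" using neq(2) cosingle_N \<open>C \<noteq> {}\<close> by blast
        then show ?thesis by (intro disjI2)
      next
        fix c d
        assume R: "c \<in> C" "R k = (\<lambda>x y. (x = c) \<noteq> (y = d))"
        obtain x where "x \<in> C" "x \<noteq> c" using other by blast
        have "?A k x = C - {x}" using neq(2) \<open>x \<in> C\<close> by blast
        then have "?A (Suc k) x = C" using R(2,1) \<open>x \<noteq> c\<close> by (rule cosingle_diff)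
        then have "\<exists>x\<in>C. ?A (Suc k) x = C" using \<open>x \<in> C\<close> by blast
        then show ?thesis by (intro disjI2)
      qed
    next
      case (even c d)
      obtain x where x: "x \<in> C" "?A k x = C - {d}" using even(5) other[of c] by blast
      from turn show ?thesis
      proof (elim disjE conjE bexE)
        assume R: "h (Suc k) = h k" "R k = (=)"
        have "?A (Suc k) c = {d}"
          using single[OF even(4)] R even(3) by auto
        moreover have "\<forall>x\<in>C - {c}. ?A (Suc k) x = C - {d}"
          using cosingle_E even(5) R by blast
        ultimately show ?thesis using even(1-3) R(1) by metis
      next
        assume "R k = (\<noteq>)"
        then have "\<exists>x\<in>C. ?A (Suc k) x = C" using x cosingle_N by blast
        then show ?thesis by (intro disjI2)
      next
        fix c' d'
        assume h: "h (Suc k) \<noteq> h k" and R: "c' \<in> C" "d' \<in> C" "R k = (\<lambda>x y. (x = c') \<noteq> (y = d'))"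
        show ?thesis
        \<comment> \<open>If the special colour of the corner is \<open>d\<close>, the pattern
          survives with singletons and complements exchanged; otherwise a start colour with set
          \<open>C - {d}\<close> now reaches everything.\<close>
        proof (cases "d = c'")
          case True
          have "?A (Suc k) c = C - {d'}"
            using single[OF even(4)] R True by auto
          moreover have "\<forall>x\<in>C - {c}. ?A (Suc k) x = {d'}"
            using cosingle_same even(5) R True by blast
          moreover have "h (Suc k) \<noteq> h 0" using h even(1) by blast
          ultimately show ?thesis using even(2) R(2) by blast
        next
          case False
          with x(2) R(3,1) have "?A (Suc k) x = C" by (rule cosingle_diff)
          then have "\<exists>x\<in>C. ?A (Suc k) x = C" using x(1) by blast
          then show ?thesis by (intro disjI2)
        qed
      qed
    next
      case (odd c d)
      from turn show ?thesis
      proof (elim disjE conjE bexE)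
        assume R: "h (Suc k) = h k" "R k = (=)"
        have "\<forall>x\<in>C - {c}. ?A (Suc k) x = {d}"
          using single odd(5) R odd(3) by auto
        moreover have "?A (Suc k) c = C - {d}"
          using cosingle_E odd(4) R by blast
        ultimately show ?thesis using odd(1-3) R(1) by metis
      next
        assume "R k = (\<noteq>)"
        then have "\<exists>x\<in>C. ?A (Suc k) x = C" using odd(2,4) cosingle_N by blast
        then show ?thesis by (intro disjI2)
      next
        fix c' d'
        assume h: "h (Suc k) \<noteq> h k" and R: "c' \<in> C" "d' \<in> C" "R k = (\<lambda>x y. (x = c') \<noteq> (y = d'))"
        show ?thesis
        proof (cases "d = c'")
          case True
          have "\<forall>x\<in>C - {c}. ?A (Suc k) x = C - {d'}"
            using single odd(5) R True by auto
          moreover have "?A (Suc k) c = {d'}"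
            using cosingle_same odd(4) R True by blast
          moreover have "h (Suc k) = h 0" using h odd(1) by blast
          ultimately show ?thesis using odd(2) R(2) by blast
        next
          case False
          with odd(4) R(3,1) have "?A (Suc k) c = C" by (rule cosingle_diff)
          then have "\<exists>x\<in>C. ?A (Suc k) x = C" using odd(2) by blast
          then show ?thesis by (intro disjI2)
        qed
      qed
    next
      case (all x)
      then have "\<exists>x\<in>C. ?A (Suc k) x = C" using full[OF k] by blast
      then show ?thesis by (intro disjI2)
    qed
  qed
  \<comment> \<open>The number of corners is even and positive, which leaves the third and the last
    alternative; in the third, a colour different from \<open>c\<close> and \<open>d\<close> is
    reachable from itself.\<close>
  have "\<exists>x\<in>C. x \<in> ?A n x"
    using inv[OF order_refl]
  proof (elim disjE conjE bexE)
    fix c d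
    assume "\<forall>x\<in>C - {c}. ?A n x = C - {d}"
    moreover obtain x where "x \<in> C" "x \<noteq> c" "x \<noteq> d" using third by blast
    ultimately show ?thesis by blast
  qed (use closed ex_corner in blast)+
  then show ?thesis using reach_walk by metis
qed

section \<open>The brick condition on a cycle, and solvable regions\<close>

lemma brick_at_update:
  assumes "d \<in> dirs" "d' \<in> dirs" "d \<noteq> d'"
  shows "brick_at F (\<tau>(side F u d := x, side F u d' := y)) u \<longleftrightarrow>
    (if d' = - d then (x = y) \<noteq> (\<tau> (side F u (rot d)) = \<tau> (side F u (- rot d)))
     else (x = \<tau> (side F u (- d))) \<noteq> (y = \<tau> (side F u (- d'))))"
proof -
  let ?\<tau> = "\<tau>(side F u d := x, side F u d' := y)"
  have upd: "?\<tau> (side F u d) = x" "?\<tau> (side F u d') = y"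
    using assms(3) by (simp_all add: side_inj)
  have old: "?\<tau> (side F u z) = \<tau> (side F u z)" if "z \<noteq> d" "z \<noteq> d'" for z
    using that by (simp add: side_inj)
  note D = dirs_distinct[OF assms(1)]
  consider "d' = - d" | "d' = rot d" | "d' = - rot d"
    using dirs_cases[OF assms(1,2)] assms(3) by blast
  then show ?thesis
  proof cases
    case 1
    then show ?thesis
      unfolding brick_at_dir[OF assms(1)] using upd old[of "rot d"] old[of "- rot d"] D(3-6)
      by (simp del: fun_upd_apply)
  next
    case 2
    then show ?thesis
      unfolding brick_at_dir[OF assms(1)] using upd old[of "- d"] old[of "- rot d"] D(2,4,5,7)
      by (metis (no_types, lifting))
  next
    case 3
    then have "rot d = - d'" by simp
    then show ?thesis
      unfolding brick_at_dir[OF assms(1)] using 3 upd old[of "- d"] old[of "rot d"] D(2,3,6,7)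
      by (metis (no_types, lifting))
  qed
qed

text \<open>Colours of edges not inside \<open>S\<close> are arbitrary and stay fixed, so that
  \<open>S\<close> can be solved last, after the cells outside it.\<close>

definition solvable_on :: "point set set \<Rightarrow> 'c set \<Rightarrow> point set \<Rightarrow> bool" where
  "solvable_on F C S \<longleftrightarrow> (\<forall>\<tau>. range \<tau> \<subseteq> C \<longrightarrow>
     (\<exists>\<tau>'. range \<tau>' \<subseteq> C \<and> (\<forall>x. x \<notin> Kept ` {e \<in> F. e \<subseteq> S} \<longrightarrow> \<tau>' x = \<tau> x) \<and>
       (\<forall>u\<in>S. brick_at F \<tau>' u)))"

text \<open>Satisfy \<open>v\<close> first by recolouring its edge to \<open>w\<close>, then solve
  \<open>S\<close>: no side of \<open>v\<close> is an edge inside \<open>S\<close>, so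
  \<open>v\<close> stays satisfied.\<close>

lemma solvable_on_insert:
  assumes S: "solvable_on F C S" and v: "v \<notin> S" and w: "w \<in> S" "{v, w} \<in> F"
    and F: "F \<subseteq> grid_edges" and other: "\<And>x. \<exists>y\<in>C. y \<noteq> x"
  shows "solvable_on F C (insert v S)"
  unfolding solvable_on_def
proof (intro allI impI)
  fix \<tau> :: "grid_edge \<Rightarrow> 'a"
  assume \<tau>: "range \<tau> \<subseteq> C"
  define d where "d = w - v"
  have d: "d \<in> dirs" using F w grid_edge_dir[of v w] by (auto simp: d_def)
  have side: "side F v d = Kept {v, w}" using w by (simp add: side_def d_def)
  \<comment> \<open>If the perpendicular sides differ, \<open>c\<close> must repeat the opposite
    colour; if they agree, any other colour works.\<close>
  obtain c where c: "c \<in> C"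
    "(c = \<tau> (side F v (- d))) \<noteq> (\<tau> (side F v (rot d)) = \<tau> (side F v (- rot d)))"
    using other[of "\<tau> (side F v (- d))"] \<tau> by blast
  define \<tau>1 where "\<tau>1 = \<tau>(side F v d := c)"
  have "range \<tau>1 \<subseteq> C" using \<tau> c(1) by (auto simp: \<tau>1_def)
  then obtain \<tau>2 where \<tau>2: "range \<tau>2 \<subseteq> C" "\<And>x. x \<notin> Kept ` {e \<in> F. e \<subseteq> S} \<Longrightarrow> \<tau>2 x = \<tau>1 x"
    "\<And>u. u \<in> S \<Longrightarrow> brick_at F \<tau>2 u"
    using S[unfolded solvable_on_def, THEN spec[of _ \<tau>1]] by auto
  have "brick_at F \<tau>1 v"
  proof -
    have "\<tau>1 (side F v d) = c" by (simp add: \<tau>1_def)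
    moreover have old: "\<tau>1 (side F v d') = \<tau> (side F v d')" if "d' \<noteq> d" for d'
      using that by (simp add: \<tau>1_def side_inj)
    moreover note dirs_distinct(2,3,5)[OF d, THEN old]
    ultimately show ?thesis unfolding brick_at_dir[OF d] using c(2) by metis
  qed
  moreover have "\<tau>2 (side F v d') = \<tau>1 (side F v d')" for d'
    using v by (intro \<tau>2(2)) (auto simp: side_def)
  ultimately have "brick_at F \<tau>2 v"
    by (simp add: brick_at_def)
  moreover have "\<tau>2 x = \<tau> x" if "x \<notin> Kept ` {e \<in> F. e \<subseteq> insert v S}" for x
  proof -
    have "x \<noteq> side F v d" using that w by (auto simp: side)
    then show ?thesis using \<tau>2(2)[of x] that by (auto simp: \<tau>1_def)
  qed
  ultimately show "\<exists>\<tau>'. range \<tau>' \<subseteq> C \<and>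
      (\<forall>x. x \<notin> Kept ` {e \<in> F. e \<subseteq> insert v S} \<longrightarrow> \<tau>' x = \<tau> x) \<and> (\<forall>u\<in>insert v S. brick_at F \<tau>' u)"
    using \<tau>2 by blast
qed

text \<open>Only the edges \<open>e i\<close> of the cycle itself are recoloured, not its chords.
  Each cell then imposes a relation between the colours of two consecutive edges, and
  \<open>closed_walk\<close> applies.\<close>

lemma solvable_on_cycle:
  fixes v :: "nat \<Rightarrow> point"
  assumes n: "3 \<le> n" and v_eq: "\<And>i j. v i = v j \<longleftrightarrow> i mod n = j mod n"
    and edge: "\<And>i. {v i, v (Suc i)} \<in> F" and F: "F \<subseteq> grid_edges"
    and "C \<noteq> {}" and third: "\<And>x y. \<exists>z\<in>C. z \<noteq> x \<and> z \<noteq> y"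
  shows "solvable_on F C (range v)"
  unfolding solvable_on_def
proof (intro allI impI)
  fix \<tau> :: "grid_edge \<Rightarrow> 'a"
  assume \<tau>: "range \<tau> \<subseteq> C"
  then have \<tau>C: "\<tau> x \<in> C" for x by blast
  define e where "e i = Kept {v i, v (Suc i)}" for i
  define h where "h i \<longleftrightarrow> snd (v i) = snd (v (Suc i))" for i
  \<comment> \<open>The edges \<open>e i\<close> and \<open>e (Suc i)\<close> meet at
    \<open>v (Suc i)\<close>, from which \<open>p i\<close> and \<open>q i\<close> point to the
    predecessor and the successor.\<close>
  define R where "R i x y \<longleftrightarrow> brick_at F (\<tau>(e i := x, e (Suc i) := y)) (v (Suc i))" for i x y
  define p where "p i = v i - v (Suc i)" for i
  define q where "q i = v (Suc (Suc i)) - v (Suc i)" for i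
  have two: "v i \<noteq> v (Suc (Suc i))" for i
    using n unfolding v_eq by (auto simp: mod_Suc split: if_splits)
  have e_cong: "e i = e j" if "v i = v j" for i j
  proof -
    have "v (Suc i) = v (Suc j)" using that unfolding v_eq by (metis mod_Suc_eq)
    then show ?thesis using that by (simp add: e_def)
  qed
  \<comment> \<open>An edge traversed again in reverse would mean a step out and straight back,
    which \<open>two\<close> excludes.\<close>
  have e_eqD: "v i = v j" if "e i = e j" for i j
  proof (rule ccontr)
    assume "v i \<noteq> v j"
    then have "v i = v (Suc j)" "v (Suc i) = v j"
      using that by (auto simp: e_def doubleton_eq_iff)
    then have "v (Suc (Suc j)) = v j"
      unfolding v_eq by (metis mod_Suc_eq)
    then show False using two by metis
  qed
  have pq: "p i \<in> dirs" "q i \<in> dirs" "p i \<noteq> q i" for i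
    using edge[of i] edge[of "Suc i"] F two[of i]
      grid_edge_dir[of "v (Suc i)" "v i"] grid_edge_dir[of "v (Suc i)" "v (Suc (Suc i))"]
    by (auto simp: p_def q_def insert_commute)
  have side_p: "side F (v (Suc i)) (p i) = e i" for i
    using edge[of i] by (simp add: side_def p_def e_def insert_commute)
  have side_q: "side F (v (Suc i)) (q i) = e (Suc i)" for i
    using edge[of "Suc i"] by (simp add: side_def q_def e_def)
  have h_turn: "h (Suc i) = h i \<longleftrightarrow> q i = - p i" for i
  proof -
    have "h i \<longleftrightarrow> snd (p i) = 0" "h (Suc i) \<longleftrightarrow> snd (q i) = 0"
      by (auto simp: h_def p_def q_def)
    then show ?thesis using pq[of i] by (auto simp: dirs_def)
  qed
  \<comment> \<open>Going straight gives equality or inequality, depending on the perpendicular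
    sides; at a corner, both edges are compared with the fixed colours opposite to them.\<close>
  have R_iff: "R i x y \<longleftrightarrow>
      (if q i = - p i
       then (x = y) \<noteq> (\<tau> (side F (v (Suc i)) (rot (p i))) = \<tau> (side F (v (Suc i)) (- rot (p i))))
       else (x = \<tau> (side F (v (Suc i)) (- p i))) \<noteq> (y = \<tau> (side F (v (Suc i)) (- q i))))" for i x y
    using brick_at_update[OF pq, of F \<tau> "v (Suc i)" i x y] by (simp only: side_p side_q R_def)
  have "\<exists>f. f n = f 0 \<and> (\<forall>i\<le>n. f i \<in> C) \<and> (\<forall>i<n. R i (f i) (f (Suc i)))"
  proof (rule closed_walk[OF \<open>C \<noteq> {}\<close> third, of n h])
    show "R i = (=) \<or> R i = (\<noteq>)" if "h (Suc i) = h i" for i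
      using that unfolding h_turn by (auto simp: fun_eq_iff R_iff)
    show "\<exists>c\<in>C. \<exists>d\<in>C. R i = (\<lambda>x y. (x = c) \<noteq> (y = d))" if "h (Suc i) \<noteq> h i" for i
      using that \<tau>C unfolding h_turn by (auto simp: fun_eq_iff R_iff)
    have "v n = v 0" "v (Suc n) = v (Suc 0)"
      using n by (simp_all add: v_eq mod_Suc)
    then show "h n = h 0" by (simp add: h_def)
    show "\<exists>i<n. h (Suc i) \<noteq> h i"
    \<comment> \<open>Without corners the cells form an arithmetic progression; returning after
      \<open>n\<close> steps makes its difference vanish, but neighbouring cells differ.\<close>
    proof (rule ccontr)
      assume "\<not> ?thesis"
      then have "q i = - p i" if "i < n" for i
        using that h_turn by blast
      then have diff: "v (Suc (Suc i)) - v (Suc i) = v (Suc i) - v i" if "i < n" for i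
        using that by (simp add: p_def q_def)
      obtain a b where ab: "v 1 - v 0 = (a, b)" by fastforce
      have "v (Suc i) - v i = (a, b)" if "i \<le> n" for i
        using that by (induction i) (use ab diff in auto)
      then have "v k = v 0 + (int k * a, int k * b)" if "k \<le> n" for k
        using that
        by (induction k) (auto simp: algebra_simps diff_eq_eq zero_prod_def[symmetric])
      from this[of n] have "(int n * a, int n * b) = 0"
        using \<open>v n = v 0\<close> by simp
      then have "v 1 - v 0 = 0" using n ab by (simp add: zero_prod_def)
      then have "v 1 = v 0" by simp
      then show False using n by (simp add: v_eq)
    qed
  qed
  then obtain f where f: "f n = f 0" "\<forall>i\<le>n. f i \<in> C" "\<forall>i<n. R i (f i) (f (Suc i))"
    by blast
  \<comment> \<open>An edge determines its index only modulo \<open>n\<close>, hence the reduction;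
    by \<open>e_eqD\<close> the choice of the index does not matter.\<close>
  define \<tau>' where "\<tau>' x = (if \<exists>i. x = e i then f ((SOME i. x = e i) mod n) else \<tau> x)" for x
  have \<tau>'_e: "\<tau>' (e i) = f (i mod n)" for i
  proof -
    have "e i = e (SOME j. e i = e j)" by (rule someI) (rule refl)
    then have "i mod n = (SOME j. e i = e j) mod n" using e_eqD v_eq by blast
    then show ?thesis by (auto simp: \<tau>'_def)
  qed
  have "\<tau>' x \<in> C" for x
    using f(2) \<tau>C n by (auto simp: \<tau>'_def mod_le_divisor)
  moreover have "\<tau>' x = \<tau> x" if "x \<notin> Kept ` {e \<in> F. e \<subseteq> range v}" for x
    using that edge by (auto simp: \<tau>'_def e_def)
  moreover have "brick_at F \<tau>' (v j)" for j
  proof -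
    \<comment> \<open>The cyclic predecessor of \<open>j\<close>; adding \<open>n\<close> first
      avoids truncated subtraction at \<open>j = 0\<close>.\<close>
    define i where "i = (j + n - 1) mod n"
    have i: "i < n" using n by (simp add: i_def)
    have "Suc i mod n = Suc (j + n - 1) mod n" by (simp add: i_def mod_Suc_eq)
    then have vj: "v j = v (Suc i)" using n by (simp add: v_eq)
    \<comment> \<open>For \<open>Suc i = n\<close> the index wraps around to 0, where
      \<open>f n = f 0\<close> is needed.\<close>
    have on_e: "\<tau>' (e i) = f i" "\<tau>' (e (Suc i)) = f (Suc i)"
      using i f(1) by (cases "Suc i = n"; simp add: \<tau>'_e)+
    have off_e: "side F (v (Suc i)) d \<noteq> e k" if "d \<noteq> p i" "d \<noteq> q i" for d k
    proof
      assume *: "side F (v (Suc i)) d = e k"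
      then consider "v (Suc i) = v (Suc k)" "d = p k" | "v (Suc k) = v (Suc i) + d" "p k = - d"
        unfolding side_p[symmetric] side_eq_iff by blast
      then show False
      proof cases
        case 1
        have "v i = v k"
          using 1(1) unfolding v_eq by (simp add: mod_Suc split: if_splits)
        then have "e k = side F (v (Suc i)) (p i)" using e_cong side_p by metis
        then show False using * that(1) by (simp add: side_inj)
      next
        case 2
        then have "v k = v (Suc i)" by (simp add: p_def algebra_simps)
        then have "e k = side F (v (Suc i)) (q i)" using e_cong side_q by metis
        then show False using * that(2) by (simp add: side_inj)
      qed
    qed
    have "e i \<noteq> e (Suc i)"
      using pq(3)[of i] side_inj[of F "v (Suc i)" "p i" "q i"] by (simp add: side_p side_q)
    then have "\<tau>' (side F (v (Suc i)) d) =
        (\<tau>(e i := f i, e (Suc i) := f (Suc i))) (side F (v (Suc i)) d)" for d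
      using on_e off_e[of d] side_p[of i] side_q[of i]
      by (cases "d = p i"; cases "d = q i") (simp_all add: \<tau>'_def)
    moreover have "brick_at F (\<tau>(e i := f i, e (Suc i) := f (Suc i))) (v (Suc i))"
      using f(3) i R_def by blast
    ultimately show ?thesis unfolding vj brick_at_def by metis
  qed
  ultimately show "\<exists>\<tau>'. range \<tau>' \<subseteq> C \<and>
      (\<forall>x. x \<notin> Kept ` {e \<in> F. e \<subseteq> range v} \<longrightarrow> \<tau>' x = \<tau> x) \<and> (\<forall>u\<in>range v. brick_at F \<tau>' u)"
    by blast
qed

text \<open>A maximal solvable region containing the cycle is all of \<open>U\<close>: otherwise, by
  connectedness, some adjacent cell could be inserted.\<close>

lemma always_solvable_if_contains_cycle:
  assumes UF: "finite_connected_grid_subgraph U F"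
    and third: "\<And>x y. \<exists>z\<in>C. z \<noteq> x \<and> z \<noteq> y"
    and cycle: "contains_cycle (grid_restriction U F)"
  shows "always_solvable (grid_restriction U F) C (brick_tiles C)"
proof -
  let ?G = "grid_restriction U F"
  have fin: "finite U" and F: "F \<subseteq> {e \<in> grid_edges. e \<subseteq> U}"
    and conn: "\<And>u v. u \<in> U \<Longrightarrow> v \<in> U \<Longrightarrow> (\<lambda>p q. {p, q} \<in> F)\<^sup>*\<^sup>* u v"
    using UF by (auto simp: finite_connected_grid_subgraph_def)
  have F': "F \<subseteq> grid_edges" using F by blast
  obtain vs where "is_cycle ?G vs" using cycle contains_cycle_def by blast
  then have vs: "4 \<le> length vs" "last vs = hd vs" "distinct (butlast vs)" "set vs \<subseteq> Some ` U"
    "successively (cell_adj ?G) vs"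
    by (auto simp: is_cycle_def cells_grid_restriction)
  \<comment> \<open>The last entry of \<open>vs\<close> repeats the first, so the period is one less
    than the length.\<close>
  define n where "n = length vs - 1"
  define v where "v i = the (vs ! (i mod n))" for i
  have n: "3 \<le> n" using vs(1) by (simp add: n_def)
  have Some_v: "Some (v i) = vs ! (i mod n)" and v_U: "v i \<in> U" for i
  proof -
    have "i mod n < n" using n by simp
    then have "vs ! (i mod n) \<in> set vs" by (simp add: n_def)
    then show "Some (v i) = vs ! (i mod n)" "v i \<in> U" using vs(4) by (auto simp: v_def)
  qed
  have v_eq: "v i = v j \<longleftrightarrow> i mod n = j mod n" for i j
  proof -
    have "butlast vs ! (i mod n) = butlast vs ! (j mod n) \<longleftrightarrow> i mod n = j mod n"
      using vs(3) n by (intro nth_eq_iff_index_eq) (simp_all add: n_def)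
    moreover have "butlast vs ! (k mod n) = vs ! (k mod n)" for k
      using n by (intro nth_butlast) (simp add: n_def)
    ultimately show ?thesis using Some_v by (metis option.inject)
  qed
  have edge: "{v i, v (Suc i)} \<in> F" for i
  proof -
    have i: "i mod n < n" using n by simp
    have "vs ! n = vs ! 0"
      using vs(1,2) by (simp add: n_def last_conv_nth hd_conv_nth flip: length_greater_0_conv)
    then have "vs ! (Suc i mod n) = vs ! Suc (i mod n)"
      by (simp add: mod_Suc)
    moreover have "cell_adj ?G (vs ! (i mod n)) (vs ! Suc (i mod n))"
      using vs(5) i by (simp add: successively_conv_nth n_def)
    ultimately have "cell_adj ?G (Some (v i)) (Some (v (Suc i)))"
      by (simp add: Some_v)
    then show ?thesis by (simp add: cell_adj_grid_restriction[OF F])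
  qed
  have ne: "C \<noteq> {}" using third by blast
  let ?P = "{S. S \<subseteq> U \<and> range v \<subseteq> S \<and> solvable_on F C S}"
  have "range v \<in> ?P"
    using solvable_on_cycle[OF n v_eq edge F' ne third] v_U by blast
  moreover have "finite ?P"
    using fin by (auto intro: finite_subset[of _ "Pow U"])
  ultimately have "\<exists>S\<in>?P. \<forall>S'\<in>?P. S \<subseteq> S' \<longrightarrow> S = S'"
    by (intro finite_has_maximal) blast+
  then obtain S where "S \<in> ?P" and max: "\<forall>S'\<in>?P. S \<subseteq> S' \<longrightarrow> S = S'"
    by (rule bexE)
  then have S: "S \<subseteq> U" "range v \<subseteq> S" "solvable_on F C S" by simp_all
  have "x \<in> S" if "(\<lambda>p q. {p, q} \<in> F)\<^sup>*\<^sup>* (v 0) x" for x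
    using that
  proof induction
    case base
    then show ?case using S by blast
  next
    case (step y z)
    show ?case
    proof (rule ccontr)
      assume "z \<notin> S"
      have "{z, y} \<in> F" using step by (simp add: insert_commute)
      moreover have "\<exists>b\<in>C. b \<noteq> a" for a using third by blast
      ultimately have "solvable_on F C (insert z S)"
        using S(3) \<open>z \<notin> S\<close> step.IH F' by (intro solvable_on_insert[of F C S z y])
      moreover have "z \<in> U" using step F by blast
      ultimately have "insert z S \<in> ?P" using S by blast
      then have "S = insert z S" using max by blast
      then show False using \<open>z \<notin> S\<close> by blast
    qed
  qed
  then have "S = U" using S conn v_U by blast
  then have solv: "solvable_on F C U" using S(3) by simp
  show ?thesis
    unfolding always_solvable_def
  proof
    let ?I = "incident_edges ?G (outer ?G)"
    fix \<beta> assume \<beta>: "\<beta> \<in> ?I \<rightarrow> C"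
    obtain c where "c \<in> C" using ne by blast
    \<comment> \<open>\<open>solvable_on\<close> expects a total colouring, so the other edges get a
      default colour; edges to the outer vertex are \<open>Cut\<close> edges and never
      recoloured.\<close>
    define \<beta>' where "\<beta>' x = (if x \<in> ?I then \<beta> x else c)" for x
    have "range \<beta>' \<subseteq> C" using \<beta> \<open>c \<in> C\<close> by (auto simp: \<beta>'_def)
    then obtain \<tau> where \<tau>: "range \<tau> \<subseteq> C" "\<forall>u\<in>U. brick_at F \<tau> u"
      "\<forall>x. x \<notin> Kept ` {e \<in> F. e \<subseteq> U} \<longrightarrow> \<tau> x = \<beta>' x"
      using solv[unfolded solvable_on_def, THEN spec[of _ \<beta>']] by blast
    have "\<tau> x = \<beta> x" if "x \<in> ?I" for x
    proof -
      have "x \<notin> Kept ` {e \<in> F. e \<subseteq> U}" using that by (auto simp: incident_edges_outer)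
      then show ?thesis using \<tau>(3) that by (simp add: \<beta>'_def)
    qed
    then have "full_extension ?G C (brick_tiles C) \<beta> \<tau>"
      unfolding full_extension_grid_restriction using \<tau> by blast
    then show "\<exists>\<tau>. full_extension ?G C (brick_tiles C) \<beta> \<tau>" by blast
  qed
qed

text \<open>Both directions use the bound on the number of colours only in this form. As
  \<open>card\<close> is 0 on infinite sets, these need a disjunct of their own.\<close>

lemma ex_third_colour:
  assumes "infinite C \<or> 3 \<le> card C"
  shows "\<exists>z\<in>C. z \<noteq> x \<and> z \<noteq> y"
proof (rule ccontr)
  assume "\<not> ?thesis"
  then have "C \<subseteq> {x, y}" by blast
  then have "finite C" "card C \<le> card {x, y}" by (auto intro: finite_subset card_mono)
  moreover have "card {x, y} \<le> 2" by (simp add: card_insert_if)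
  ultimately show False using assms by simp
qed

theorem theorem1:
  fixes C :: "'c set" and G :: "(point option, grid_edge) board_graph"
  assumes "infinite C \<or> 3 \<le> card C"
    and "square_grid_board G"
  shows "always_solvable G C (brick_tiles C) \<longleftrightarrow> contains_cycle G"
proof -
  obtain U F where UF: "finite_connected_grid_subgraph U F" and G: "G = grid_restriction U F"
    using assms(2) unfolding square_grid_board_def by blast
  note third = ex_third_colour[OF assms(1)]
  obtain a b where ab: "a \<in> C" "b \<in> C" "a \<noteq> b" using third by metis
  show ?thesis
    unfolding G
  proof
    assume "always_solvable (grid_restriction U F) C (brick_tiles C)"
    with UF ab show "contains_cycle (grid_restriction U F)"
      by (rule contains_cycle_if_always_solvable)
  next
    assume "contains_cycle (grid_restriction U F)"
    with UF third show "always_solvable (grid_restriction U F) C (brick_tiles C)"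
      by (rule always_solvable_if_contains_cycle)
  qed
qed

end
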